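(* Let $d,n\ge 1$ be integers and let $V$ be an $n$-dimensional real vector space of continuous odd maps $S^d \to \mathbb{R}$. Then there is a set $A \subset S^d$ of diameter at most $\delta = \pi-p_{n+1}(\mathbb{R}P^d)$ such that for every $f \in V$ the restriction $f|_A$ is not strictly positive (i.e., it is not the case that $f(x)>0$ for all $x\in A$).
   Context: $S^d\subset\mathbb{R}^{d+1}$ is the unit sphere with the geodesic (angular) metric $d(x,y)=\arccos\langle x,y\rangle$, so antipodal points are at distance $\pi$; diameters of subsets of $S^d$ are taken in this metric. $\mathbb{R}P^d=S^d/(x\sim -x)$ carries the quotient metric: the distance between two points is the angle in $[0,\pi/2]$ between the corresponding lines, i.e. $\arccos|\langle x,y\rangle|$. A map $f\colon S^d\to\mathbb{R}$ is odd if $f(-x)=-f(x)$ for all $x\in S^d$. For a compact metric space $(X,d)$ and $m\ge 1$, $p_m(X)=\sup\{\varepsilon>0 : \text{there are } x_1,\dots,x_m\in X \text{ with } d(x_i,x_j)\ge\varepsilon \text{ for all } i\ne j\}$. *)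

theory Defs
  imports "HOL-Analysis.Analysis" "HOL-Library.Function_Algebras"
begin

text \<open>The unit sphere of a Euclidean space as a type: for \<open>DIM('a) = d + 1\<close> this is the
  \<open>d\<close>-sphere. Its distance is the geodesic one, not the chordal one inherited
  from \<open>'a\<close>; the two induce the same topology
  (\<open>continuous_on_Rep_usphere\<close>, \<open>continuous_on_Abs_usphere\<close>).\<close>

typedef (overloaded) 'a usphere = "sphere (0 :: 'a :: euclidean_space) 1"
  morphisms Rep_usphere Abs_usphere
  using vector_choose_size[of 1] by auto

setup_lifting type_definition_usphere

lemma norm_Rep_usphere [simp]: "norm (Rep_usphere x) = 1"
  using Rep_usphere[of x] by simp

lemma inner_usphere_self [simp]: "Rep_usphere x \<bullet> Rep_usphere x = 1"
  by (simp add: dot_square_norm)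

lemma abs_inner_usphere_le [simp]: "\<bar>Rep_usphere x \<bullet> Rep_usphere y\<bar> \<le> 1"
  using Cauchy_Schwarz_ineq2[of "Rep_usphere x" "Rep_usphere y"] by simp

lemma inner_usphere_bounds [simp]:
  "Rep_usphere x \<bullet> Rep_usphere y \<le> 1" "- 1 \<le> Rep_usphere x \<bullet> Rep_usphere y"
  using abs_inner_usphere_le[of x y] by linarith+

lemma arccos_inner_triangle:
  fixes u v w :: "'a :: real_inner"
  assumes "norm u = 1" "norm v = 1" "norm w = 1"
  shows "arccos (u \<bullet> w) \<le> arccos (u \<bullet> v) + arccos (v \<bullet> w)"
proof -
  have bnd: "\<bar>a \<bullet> b\<bar> \<le> 1" if "norm a = 1" "norm b = 1" for a b :: 'a
    using Cauchy_Schwarz_ineq2[of a b] that by simp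
  define a where "a = arccos (u \<bullet> v)"
  define b where "b = arccos (v \<bullet> w)"
  have uv: "\<bar>u \<bullet> v\<bar> \<le> 1" and vw: "\<bar>v \<bullet> w\<bar> \<le> 1" and uw: "\<bar>u \<bullet> w\<bar> \<le> 1"
    using bnd assms by auto
  have a: "0 \<le> a" "a \<le> pi" "cos a = u \<bullet> v"
    unfolding a_def using uv by (auto simp: arccos_lbound arccos_ubound cos_arccos_abs abs_le_iff)
  have b: "0 \<le> b" "b \<le> pi" "cos b = v \<bullet> w"
    unfolding b_def using vw by (auto simp: arccos_lbound arccos_ubound cos_arccos_abs abs_le_iff)
  show ?thesis
  proof (cases "a + b \<le> pi")
    case False
    moreover have "arccos (u \<bullet> w) \<le> pi" using uw by (intro arccos_ubound) auto
    ultimately show ?thesis unfolding a_def b_def by linarith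
  next
    case True
    have vv: "v \<bullet> v = 1" "u \<bullet> u = 1" "w \<bullet> w = 1"
      using assms by (simp_all add: dot_square_norm)
    define u' where "u' = u - (u \<bullet> v) *\<^sub>R v"
    define w' where "w' = w - (v \<bullet> w) *\<^sub>R v"
    have "norm u' ^ 2 = 1 - (u \<bullet> v)\<^sup>2"
      unfolding power2_norm_eq_inner u'_def
      by (simp add: inner_diff_left inner_diff_right vv inner_commute power2_eq_square)
    also have "\<dots> = sin a ^ 2" by (simp add: sin_squared_eq a)
    finally have nu: "norm u' = sin a"
      by (rule power2_eq_imp_eq) (auto intro: sin_ge_zero a)
    have "norm w' ^ 2 = 1 - (v \<bullet> w)\<^sup>2"
      unfolding power2_norm_eq_inner w'_def
      by (simp add: inner_diff_left inner_diff_right vv inner_commute power2_eq_square)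
    also have "\<dots> = sin b ^ 2" by (simp add: sin_squared_eq b)
    finally have nw: "norm w' = sin b"
      by (rule power2_eq_imp_eq) (auto intro: sin_ge_zero b)
    have "u \<bullet> w = cos a * cos b + u' \<bullet> w'"
      unfolding u'_def w'_def a b
      by (simp add: inner_diff_left inner_diff_right vv inner_commute)
    moreover have "\<bar>u' \<bullet> w'\<bar> \<le> sin a * sin b"
      using Cauchy_Schwarz_ineq2[of u' w'] by (simp add: nu nw)
    ultimately have "cos (a + b) \<le> u \<bullet> w" by (simp add: cos_add)
    then have "arccos (u \<bullet> w) \<le> arccos (cos (a + b))"
      using uw by (intro arccos_le_arccos) auto
    also have "\<dots> = a + b" using True a b by (intro arccos_cos) auto
    finally show ?thesis unfolding a_def b_def .
  qed
qed

lemma arccos_eq_0_iff: "\<bar>t\<bar> \<le> 1 \<Longrightarrow> arccos t = 0 \<longleftrightarrow> t = 1"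
  using arccos_eq_iff[of t 1] by simp

lemma inner_unit_eq_1_iff:
  fixes u v :: "'a :: real_inner"
  assumes "norm u = 1" "norm v = 1"
  shows "u \<bullet> v = 1 \<longleftrightarrow> u = v"
proof -
  have "u \<bullet> u = 1" "v \<bullet> v = 1" using assms by (simp_all add: dot_square_norm)
  then have "norm (u - v) ^ 2 = 2 - 2 * (u \<bullet> v)"
    unfolding power2_norm_eq_inner by (simp add: inner_diff_left inner_diff_right inner_commute)
  then show ?thesis by (auto simp: assms dot_square_norm)
qed

instantiation usphere :: (euclidean_space) metric_space
begin

definition dist_usphere :: "'a usphere \<Rightarrow> 'a usphere \<Rightarrow> real" where
  "dist_usphere x y = arccos (Rep_usphere x \<bullet> Rep_usphere y)"

definition uniformity_usphere :: "('a usphere \<times> 'a usphere) filter" where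
  "uniformity_usphere = (INF e\<in>{0<..}. principal {(x, y). dist x y < e})"

definition open_usphere :: "'a usphere set \<Rightarrow> bool" where
  "open_usphere U \<longleftrightarrow> (\<forall>x\<in>U. \<forall>\<^sub>F (x', y) in uniformity. x' = x \<longrightarrow> y \<in> U)"

instance
proof
  fix x y z :: "'a usphere"
  show "dist x y = 0 \<longleftrightarrow> x = y"
    by (simp add: dist_usphere_def arccos_eq_0_iff inner_unit_eq_1_iff Rep_usphere_inject)
  show "dist x y \<le> dist x z + dist y z"
    using arccos_inner_triangle[of "Rep_usphere x" "Rep_usphere z" "Rep_usphere y"]
    by (simp add: dist_usphere_def inner_commute)
qed (simp_all only: uniformity_usphere_def open_usphere_def)

end

instantiation usphere :: (euclidean_space) uminus
begin

lift_definition uminus_usphere :: "'a usphere \<Rightarrow> 'a usphere" is uminus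
  by simp

instance ..

end

lemma dist_usphere_le_pi: "dist (x :: 'a :: euclidean_space usphere) y \<le> pi"
  by (simp add: dist_usphere_def arccos_ubound)

lemma continuous_on_Rep_usphere: "continuous_on UNIV (Rep_usphere :: 'a :: euclidean_space usphere \<Rightarrow> 'a)"
proof -
  have "(Rep_usphere \<longlongrightarrow> Rep_usphere x) (at x)" for x :: "'a usphere"
  proof -
    have eq: "dist (Rep_usphere y) (Rep_usphere x) = sqrt (2 - 2 * cos (dist y x))"
      for y :: "'a usphere"
      unfolding dist_norm norm_eq_sqrt_inner
      by (simp add: inner_diff_left inner_diff_right inner_commute dist_usphere_def
          cos_arccos_abs)
    have "((\<lambda>y. sqrt (2 - 2 * cos (dist y x))) \<longlongrightarrow> sqrt (2 - 2 * cos (dist x x))) (at x)"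
      by (intro tendsto_intros)
    then show ?thesis by (subst tendsto_dist_iff) (simp add: eq)
  qed
  then show ?thesis by (simp add: continuous_on_def)
qed

lemma continuous_on_Abs_usphere:
  "continuous_on (sphere 0 1) (Abs_usphere :: 'a :: euclidean_space \<Rightarrow> 'a usphere)"
proof -
  have "(Abs_usphere \<longlongrightarrow> Abs_usphere x) (at x within sphere 0 1)" if x: "x \<in> sphere 0 1" for x :: 'a
  proof -
    have xx: "x \<bullet> x = 1" using x by (simp add: dot_square_norm)
    have "((\<lambda>y. arccos (max (-1) (min 1 (y \<bullet> x)))) \<longlongrightarrow> arccos (max (-1) (min 1 (x \<bullet> x)))) (at x within sphere 0 1)"
      by (rule continuous_on_tendsto_compose[OF continuous_on_arccos'])
         (auto intro!: tendsto_intros simp: eventually_at_filter)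
    then have *: "((\<lambda>y. arccos (max (-1) (min 1 (y \<bullet> x)))) \<longlongrightarrow> 0) (at x within sphere 0 1)"
      by (simp add: xx)
    have "\<forall>\<^sub>F y in at x within sphere 0 1.
        arccos (max (-1) (min 1 (y \<bullet> x))) = dist (Abs_usphere y) (Abs_usphere x)"
      unfolding eventually_at_filter
    proof (intro always_eventually allI impI)
      fix y :: 'a assume y: "y \<in> sphere 0 1"
      have "\<bar>y \<bullet> x\<bar> \<le> 1" using Cauchy_Schwarz_ineq2[of y x] x y by simp
      then show "arccos (max (-1) (min 1 (y \<bullet> x))) = dist (Abs_usphere y) (Abs_usphere x)"
        using x y by (simp add: dist_usphere_def Abs_usphere_inverse)
    qed
    from Lim_transform_eventually[OF * this] show ?thesis by (subst tendsto_dist_iff)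
  qed
  then show ?thesis by (simp add: continuous_on_def)
qed

lemma compact_UNIV_usphere: "compact (UNIV :: 'a :: euclidean_space usphere set)"
proof -
  have "compact (Abs_usphere ` sphere (0 :: 'a) 1)"
    by (intro compact_continuous_image continuous_on_Abs_usphere) simp
  also have "Abs_usphere ` sphere (0 :: 'a) 1 = UNIV"
    by (metis Rep_usphere Rep_usphere_inverse image_eqI UNIV_eq_I)
  finally show ?thesis .
qed

text \<open>Real projective space, with the quotient metric (the angle between lines).\<close>

quotient_type (overloaded) 'a projective = "'a :: euclidean_space usphere" / "\<lambda>x y. x = y \<or> x = - y"
proof (rule equivpI)
  have [simp]: "- (- x) = x" for x :: "'a usphere" by transfer simp
  show "symp (\<lambda>x y :: 'a usphere. x = y \<or> x = - y)" by (auto simp: symp_def)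
  show "transp (\<lambda>x y :: 'a usphere. x = y \<or> x = - y)" by (auto simp: transp_def)
qed (auto simp: reflp_def)

instantiation projective :: (euclidean_space) metric_space
begin

lift_definition dist_projective :: "'a projective \<Rightarrow> 'a projective \<Rightarrow> real" is
  "\<lambda>x y. arccos \<bar>Rep_usphere x \<bullet> Rep_usphere y\<bar>"
  by (auto simp: uminus_usphere.rep_eq)

definition uniformity_projective :: "('a projective \<times> 'a projective) filter" where
  "uniformity_projective = (INF e\<in>{0<..}. principal {(x, y). dist x y < e})"

definition open_projective :: "'a projective set \<Rightarrow> bool" where
  "open_projective U \<longleftrightarrow> (\<forall>x\<in>U. \<forall>\<^sub>F (x', y) in uniformity. x' = x \<longrightarrow> y \<in> U)"

instance
proof
  fix x y z :: "'a projective"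
  show "dist x y = 0 \<longleftrightarrow> x = y"
  proof transfer
    fix x y :: "'a usphere"
    have "\<bar>Rep_usphere x \<bullet> Rep_usphere y\<bar> = 1 \<longleftrightarrow>
        Rep_usphere x \<bullet> Rep_usphere y = 1 \<or> Rep_usphere x \<bullet> - Rep_usphere y = 1"
      by auto
    also have "\<dots> \<longleftrightarrow> Rep_usphere x = Rep_usphere y \<or> Rep_usphere x = - Rep_usphere y"
      by (subst (1 2) inner_unit_eq_1_iff) auto
    finally show "arccos \<bar>Rep_usphere x \<bullet> Rep_usphere y\<bar> = 0 \<longleftrightarrow> x = y \<or> x = - y"
      by (simp add: arccos_eq_0_iff uminus_usphere.rep_eq flip: Rep_usphere_inject)
  qed
  show "dist x y \<le> dist x z + dist y z"
  proof transfer
    fix x y z :: "'a usphere"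
    let ?u = "Rep_usphere x" and ?w = "Rep_usphere y" and ?v = "Rep_usphere z"
    obtain u where u: "u = ?u \<or> u = - ?u" "\<bar>?u \<bullet> ?v\<bar> = u \<bullet> ?v"
      by (metis abs_if inner_minus_left)
    obtain w where w: "w = ?w \<or> w = - ?w" "\<bar>?w \<bullet> ?v\<bar> = ?v \<bullet> w"
      by (metis abs_if inner_minus_left inner_commute)
    have uw: "\<bar>?u \<bullet> ?w\<bar> = \<bar>u \<bullet> w\<bar>" using u(1) w(1) by auto
    have "\<bar>u \<bullet> w\<bar> \<le> 1" unfolding uw[symmetric] by simp
    then have "arccos \<bar>u \<bullet> w\<bar> \<le> arccos (u \<bullet> w)" by (intro arccos_le_arccos) auto
    also have "\<dots> \<le> arccos (u \<bullet> ?v) + arccos (?v \<bullet> w)"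
      by (rule arccos_inner_triangle) (use u(1) w(1) in auto)
    finally show "arccos \<bar>?u \<bullet> ?w\<bar> \<le> arccos \<bar>?u \<bullet> ?v\<bar> + arccos \<bar>?w \<bullet> ?v\<bar>"
      by (simp add: u(2) w(2) uw)
  qed
qed (simp_all only: uniformity_projective_def open_projective_def)

end

lemma dist_projective_le: "dist (x :: 'a :: euclidean_space projective) y \<le> pi / 2"
proof transfer
  fix x y :: "'a usphere"
  show "arccos \<bar>Rep_usphere x \<bullet> Rep_usphere y\<bar> \<le> pi / 2"
    using arccos_le_arccos[of 0 "\<bar>Rep_usphere x \<bullet> Rep_usphere y\<bar>"] by simp
qed

lemma compact_UNIV_projective: "compact (UNIV :: 'a :: euclidean_space projective set)"
proof -
  have le: "dist (abs_projective x) (abs_projective y) \<le> dist x y" for x y :: "'a usphere"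
    unfolding dist_projective.abs_eq dist_usphere_def by (intro arccos_le_arccos) auto
  have "continuous_on UNIV (abs_projective :: 'a usphere \<Rightarrow> _)"
    unfolding continuous_on_iff by (meson le le_less_trans)
  then have "compact (range (abs_projective :: 'a usphere \<Rightarrow> _))"
    by (intro compact_continuous_image compact_UNIV_usphere)
  also have "range (abs_projective :: 'a usphere \<Rightarrow> _) = UNIV"
    by (auto intro: projective.abs_induct)
  finally show ?thesis .
qed

text \<open>The supremum is over a set of reals that is bounded when \<open>m \<ge> 2\<close> and \<open>X\<close> is
  compact; for \<open>m = 1\<close> the set is unbounded and the value is unspecified.\<close>

definition packing_distance :: "nat \<Rightarrow> 'a :: metric_space set \<Rightarrow> real" where
  "packing_distance m X = Sup {\<epsilon>. \<epsilon> > 0 \<and> (\<exists>x :: nat \<Rightarrow> 'a. (\<forall>i\<in>{1..m}. x i \<in> X) \<and>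
     (\<forall>i\<in>{1..m}. \<forall>j\<in>{1..m}. i \<noteq> j \<longrightarrow> dist (x i) (x j) \<ge> \<epsilon>))}"

text \<open>Pointwise scalar multiplication; addition is pointwise by the library instances.\<close>

instantiation "fun" :: (type, real_vector) real_vector
begin

definition scaleR_fun :: "real \<Rightarrow> ('a \<Rightarrow> 'b) \<Rightarrow> 'a \<Rightarrow> 'b" where
  "scaleR_fun c f = (\<lambda>x. c *\<^sub>R f x)"

instance
  by standard (auto simp: scaleR_fun_def fun_eq_iff scaleR_add_right scaleR_add_left)

end

definition odd_map :: "('a :: uminus \<Rightarrow> real) \<Rightarrow> bool" where
  "odd_map f \<longleftrightarrow> (\<forall>x. f (- x) = - f x)"

end

theory Submission
  imports Defs
begin

text \<open>
  Choose \<open>n + 1\<close> lines in \<open>\<real>\<^sup>d\<^sup>+\<^sup>1\<close> whose pairwise angles are at least \<open>\<epsilon> = p\<^sub>n\<^sub>+\<^sub>1(\<real>P\<^sup>d)\<close>; such an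
  optimal configuration exists because \<open>\<real>P\<^sup>d\<close> is compact (\<open>packing_distance_attained\<close>) and
  infinite. Let \<open>y\<^sub>i\<close> be unit vectors spanning these lines. The \<open>n + 1\<close> evaluations
  \<open>f \<mapsto> f(y\<^sub>i)\<close> are linear functionals on a space of dimension \<open>n\<close>, so they satisfy a
  nontrivial relation \<open>\<Sum>\<^sub>i c\<^sub>i f(y\<^sub>i) = 0\<close> (\<open>linear_relation_between_evaluations\<close>). Since every
  \<open>f \<in> V\<close> is odd, replacing \<open>y\<^sub>i\<close> by \<open>- y\<^sub>i\<close> changes the sign of \<open>c\<^sub>i\<close>, so all coefficients may
  be taken to be nonnegative. Then no \<open>f \<in> V\<close> can be positive at all the points with a nonzero
  coefficient, and these points form \<open>A\<close>.

  Whichever unit vectors represent two lines at angle \<open>\<theta>\<close>, the angle between them is \<open>\<theta>\<close> or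
  \<open>\<pi> - \<theta>\<close>, hence at most \<open>\<pi> - \<theta>\<close> because \<open>\<theta> \<le> \<pi>/2\<close>
  (\<open>dist_usphere_le_pi_minus_dist_projective\<close>). So the choice of signs does not affect the bound
  \<open>\<pi> - \<epsilon>\<close> on the diameter of \<open>A\<close>.
\<close>

lemma continuous_on_Min_finite:
  fixes f :: "'i \<Rightarrow> 'a::topological_space \<Rightarrow> 'b::linorder_topology"
  assumes "finite P" "P \<noteq> {}" "\<And>p. p \<in> P \<Longrightarrow> continuous_on S (f p)"
  shows "continuous_on S (\<lambda>x. Min ((\<lambda>p. f p x) ` P))"
  using assms
proof (induction P rule: finite_ne_induct)
  case (insert p P)
  then have "Min ((\<lambda>q. f q x) ` insert p P) = min (f p x) (Min ((\<lambda>q. f q x) ` P))" for x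
    by simp
  with insert show ?case by (simp add: continuous_on_min)
qed simp

text \<open>The smallest of the pairwise distances is a continuous function on the compact product
  \<open>X\<^sup>\<nat>\<close>, so it has a maximum \<open>M\<close>. A number \<open>\<epsilon> > 0\<close> is admissible in the definition of the
  packing distance iff \<open>\<epsilon> \<le> M\<close>; the cardinality assumption ensures \<open>M > 0\<close>, so that the
  supremum is over a nonempty set and equals \<open>M\<close>.\<close>

lemma packing_distance_attained:
  fixes X :: "'a::metric_space set"
  assumes "compact X" "m \<ge> 2" "infinite X \<or> card X \<ge> m"
  obtains x :: "nat \<Rightarrow> 'a" where "\<And>i. x i \<in> X"
    "\<And>i j. i \<in> {1..m} \<Longrightarrow> j \<in> {1..m} \<Longrightarrow> i \<noteq> j \<Longrightarrow> packing_distance m X \<le> dist (x i) (x j)"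
proof -
  define P where "P = {(i, j). i \<in> {1..m} \<and> j \<in> {1..m} \<and> i \<noteq> j}"
  define g where "g = (\<lambda>x :: nat \<Rightarrow> 'a. Min ((\<lambda>p. dist (x (fst p)) (x (snd p))) ` P))"
  define K where "K = (UNIV :: nat set) \<rightarrow>\<^sub>E X"
  have "P \<subseteq> {1..m} \<times> {1..m}" by (auto simp: P_def)
  then have finP: "finite P" by (rule finite_subset) simp
  have "(1, 2) \<in> P" using assms by (simp add: P_def)
  then have neP: "P \<noteq> {}" by blast
  have le_g: "e \<le> g x \<longleftrightarrow> (\<forall>i\<in>{1..m}. \<forall>j\<in>{1..m}. i \<noteq> j \<longrightarrow> e \<le> dist (x i) (x j))" for e x
    using finP neP by (auto simp: g_def P_def)
  have K: "compact K"
    unfolding K_def using assms(1)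
    by (metis compactin_PiE compactin_euclidean_iff euclidean_product_topology)
  have "continuous_on K g"
    unfolding g_def
    by (intro continuous_on_Min_finite finP neP continuous_on_dist
        continuous_on_subset[OF continuous_on_product_coordinates subset_UNIV])
  moreover obtain S where S: "S \<subseteq> X" "finite S" "card S = m"
    using assms(3) by (metis infinite_arbitrarily_large obtain_subset_with_card_n)
  then obtain w where w: "bij_betw w {1..m} S"
    using finite_same_card_bij[of "{1..m}" S] by auto
  \<comment> \<open>Membership in \<open>K\<close> constrains every coordinate, so those outside \<open>{1..m}\<close> are
    filled with a repeated point of \<open>X\<close>.\<close>
  define u where "u = (\<lambda>i. if i \<in> {1..m} then w i else w 1)"
  have "w i \<in> S" if "i \<in> {1..m}" for i
    using w that by (auto simp: bij_betw_def)
  then have uK: "u \<in> K" using S assms(2) by (auto simp: K_def u_def)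
  ultimately obtain x where x: "x \<in> K" "\<And>y. y \<in> K \<Longrightarrow> g y \<le> g x"
    using continuous_attains_sup[OF K] by blast
  have "u i \<noteq> u j" if "(i, j) \<in> P" for i j
  proof -
    have "i \<in> {1..m}" "j \<in> {1..m}" "i \<noteq> j" using that by (simp_all add: P_def)
    then show ?thesis
      using inj_onD[OF bij_betw_imp_inj_on[OF w], of i j] unfolding u_def by metis
  qed
  then have "0 < g u"
    using finP neP by (auto simp: g_def)
  with x(2)[OF uK] have pos: "0 < g x" by simp
  have xX: "x i \<in> X" for i
    using x(1) by (auto simp: K_def)
  have "packing_distance m X = g x"
    unfolding packing_distance_def le_g[symmetric]
  proof (rule cSup_eq_maximum)
    show "g x \<in> {\<epsilon>. 0 < \<epsilon> \<and> (\<exists>x. (\<forall>i\<in>{1..m}. x i \<in> X) \<and> \<epsilon> \<le> g x)}"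
      using pos xX by (intro CollectI conjI exI[of _ x]) auto
  next
    fix e assume "e \<in> {\<epsilon>. 0 < \<epsilon> \<and> (\<exists>x. (\<forall>i\<in>{1..m}. x i \<in> X) \<and> \<epsilon> \<le> g x)}"
    then obtain y where y: "\<forall>i\<in>{1..m}. y i \<in> X" "e \<le> g y" by auto
    define z where "z = (\<lambda>i. if i \<in> {1..m} then y i else y 1)"
    have "z \<in> K" using y assms(2) by (auto simp: K_def z_def)
    moreover have "e \<le> g z" using y(2) unfolding le_g by (simp add: z_def)
    ultimately show "e \<le> g x" using x(2) by force
  qed
  then show thesis
    using that[of x] xX le_g[of "g x" x] by auto
qed

lemma sum_fun_apply: "sum f A x = (\<Sum>a\<in>A. f a x)"
  by (induction A rule: infinite_finite_induct) auto

text \<open>Restricted to \<open>B\<close>, the evaluation at \<open>y i\<close> is the vector of values \<open>b (y i)\<close>, \<open>b \<in> B\<close>.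
  There are more such vectors than coordinates, so they are linearly dependent, and a relation
  that holds on \<open>B\<close> holds on its span.\<close>

lemma linear_relation_between_evaluations:
  fixes B :: "('x \<Rightarrow> real) set" and y :: "'i \<Rightarrow> 'x"
  assumes "finite B" "finite I" "card B < card I"
  obtains c where "\<exists>i\<in>I. c i \<noteq> 0" "\<And>f. f \<in> span B \<Longrightarrow> (\<Sum>i\<in>I. c i * f (y i)) = 0"
proof -
  define v where "v = (\<lambda>i b. if b \<in> B then b (y i) else 0)"
  have "\<exists>c. (\<exists>i\<in>I. c i \<noteq> 0) \<and> (\<forall>b\<in>B. (\<Sum>i\<in>I. c i * b (y i)) = 0)"
  proof (cases "inj_on v I")
    case False
    \<comment> \<open>The notion of dependence for sets does not see a repeated vector, which gives the
      relation \<open>v i - v j = 0\<close>.\<close>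
    then obtain i j where ij: "i \<in> I" "j \<in> I" "i \<noteq> j" "v i = v j"
      by (auto simp: inj_on_def)
    define c where "c = (\<lambda>k. if k = i then 1 else if k = j then -1 else 0 :: real)"
    have "(\<Sum>k\<in>I. c k * b (y k)) = 0" if b: "b \<in> B" for b
    proof -
      have "(\<Sum>k\<in>I. c k * b (y k)) = (\<Sum>k\<in>{i, j}. c k * b (y k))"
        using ij assms(2) by (intro sum.mono_neutral_right) (auto simp: c_def)
      also have "\<dots> = b (y i) - b (y j)" using ij(3) by (simp add: c_def)
      also have "\<dots> = 0" using fun_cong[OF ij(4), of b] b by (simp add: v_def)
      finally show ?thesis .
    qed
    moreover have "c i \<noteq> 0" by (simp add: c_def)
    ultimately show ?thesis using ij(1) by blast
  next
    case True
    define \<delta> where "\<delta> = (\<lambda>(b :: 'x \<Rightarrow> real) b' :: 'x \<Rightarrow> real. if b' = b then 1 else 0 :: real)"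
    have "v i = (\<Sum>b\<in>B. b (y i) *\<^sub>R \<delta> b)" for i
    proof (rule ext)
      fix b
      show "v i b = (\<Sum>b\<in>B. b (y i) *\<^sub>R \<delta> b) b"
        using assms(1) by (simp add: sum_fun_apply scaleR_fun_def v_def \<delta>_def if_distrib cong: if_cong)
    qed
    then have sp: "v ` I \<subseteq> span (\<delta> ` B)"
      by (simp add: image_subset_iff span_sum span_scale span_base)
    have "card (\<delta> ` B) < card (v ` I)"
      using card_image_le[OF assms(1), of \<delta>] assms(3) True by (simp add: card_image)
    then have "dependent (v ` I)"
      using independent_span_bound[OF _ _ sp] assms(1) by fastforce
    then obtain u where u: "\<exists>w\<in>v ` I. u w \<noteq> 0" "(\<Sum>w\<in>v ` I. u w *\<^sub>R w) = 0"
      using dependent_finite[of "v ` I"] assms(2) by auto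
    have rel: "(\<Sum>i\<in>I. u (v i) *\<^sub>R v i) = 0"
      using u(2) True by (simp add: sum.reindex)
    have "(\<Sum>i\<in>I. u (v i) * b (y i)) = 0" if "b \<in> B" for b
      using fun_cong[OF rel, of b] that by (simp add: sum_fun_apply scaleR_fun_def v_def)
    with u(1) show ?thesis by (intro exI[of _ "\<lambda>i. u (v i)"]) auto
  qed
  then obtain c where c: "\<exists>i\<in>I. c i \<noteq> 0" "\<And>b. b \<in> B \<Longrightarrow> (\<Sum>i\<in>I. c i * b (y i)) = 0"
    by blast
  have "(\<Sum>i\<in>I. c i * f (y i)) = 0" if "f \<in> span B" for f
    using that
  proof (induction rule: span_induct_alt)
    case (step r b f)
    have "(\<Sum>i\<in>I. c i * (r *\<^sub>R b + f) (y i))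
        = r * (\<Sum>i\<in>I. c i * b (y i)) + (\<Sum>i\<in>I. c i * f (y i))"
      by (simp add: scaleR_fun_def sum_distrib_left sum.distrib[symmetric] algebra_simps)
    with step c(2) show ?case by simp
  qed simp
  with c(1) show thesis by (rule that)
qed

text \<open>Oddness turns a linear relation between evaluations into one with nonnegative
  coefficients: a point whose coefficient is negative is replaced by its antipode.\<close>

lemma odd_maps_not_positive_on_signed_points:
  fixes V :: "('x::uminus \<Rightarrow> real) set" and y :: "'i \<Rightarrow> 'x"
  assumes "0 < dim V" "finite I" "dim V < card I"
    and odd: "\<And>f. f \<in> V \<Longrightarrow> odd_map f"
  obtains J z where "J \<subseteq> I" "J \<noteq> {}" "\<And>i. z i = y i \<or> z i = - y i"
    "\<And>f. f \<in> V \<Longrightarrow> \<not> (\<forall>i\<in>J. f (z i) > 0)"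
proof -
  obtain B where B: "V \<subseteq> span B" "card B = dim V"
    using basis_exists by blast
  \<comment> \<open>An infinite basis would have cardinality \<open>0\<close>.\<close>
  with assms(1) have "finite B" by (metis card.infinite less_numeral_extra(3))
  then obtain c where c: "\<exists>i\<in>I. c i \<noteq> 0" "\<And>f. f \<in> V \<Longrightarrow> (\<Sum>i\<in>I. c i * f (y i)) = 0"
    using linear_relation_between_evaluations[of B I y] assms(2,3) B by (metis subsetD)
  define J where "J = {i \<in> I. c i \<noteq> 0}"
  define z where "z = (\<lambda>i. if c i < 0 then - y i else y i)"
  have neJ: "J \<noteq> {}" using c(1) by (auto simp: J_def)
  have "\<not> (\<forall>i\<in>J. f (z i) > 0)" if f: "f \<in> V" for f
  proof
    assume pos: "\<forall>i\<in>J. f (z i) > 0"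
    have "0 < (\<Sum>i\<in>J. \<bar>c i\<bar> * f (z i))"
      using pos neJ assms(2) by (intro sum_pos) (auto simp: J_def)
    also have "\<dots> = (\<Sum>i\<in>J. c i * f (y i))"
      using odd[OF f] by (intro sum.cong) (auto simp: z_def odd_map_def)
    also have "\<dots> = (\<Sum>i\<in>I. c i * f (y i))"
      using assms(2) by (intro sum.mono_neutral_left) (auto simp: J_def)
    also have "\<dots> = 0" by (rule c(2)[OF f])
    finally show False by simp
  qed
  then show thesis
    using that[of J z] neJ by (auto simp: J_def z_def)
qed

lemma abs_projective_uminus [simp]: "abs_projective (- x) = abs_projective x"
  by (simp add: projective.abs_eq_iff)

text \<open>With \<open>t\<close> the inner product of the two unit vectors this is
  \<open>arccos t \<le> arccos (- \<bar>t\<bar>) = \<pi> - arccos \<bar>t\<bar>\<close>.\<close>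

lemma dist_usphere_le_pi_minus_dist_projective:
  fixes x y :: "'a::euclidean_space usphere"
  shows "dist x y \<le> pi - dist (abs_projective x) (abs_projective y)"
proof -
  let ?t = "Rep_usphere x \<bullet> Rep_usphere y"
  have "arccos ?t \<le> arccos (- \<bar>?t\<bar>)" by (intro arccos_le_arccos) auto
  also have "\<dots> = pi - arccos \<bar>?t\<bar>" by (intro arccos_minus) auto
  finally show ?thesis by (simp add: dist_usphere_def dist_projective.abs_eq)
qed

text \<open>A sphere of positive dimension is connected and contains antipodal pairs, hence is
  infinite, and each line contains only two of its points.\<close>

lemma infinite_UNIV_projective:
  assumes "DIM('a::euclidean_space) \<ge> 2"
  shows "infinite (UNIV :: 'a projective set)"
proof
  assume fin: "finite (UNIV :: 'a projective set)"
  have "x = rep_projective (abs_projective x) \<or> x = - rep_projective (abs_projective x)"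
    for x :: "'a usphere"
    using projective.abs_eq_iff[of x "rep_projective (abs_projective x)"]
    by (simp add: Quotient3_abs_rep[OF Quotient3_projective])
  then have "(UNIV :: 'a usphere set) \<subseteq> (\<Union>p. {rep_projective p, - rep_projective p})"
    by blast
  moreover have "finite (\<Union>p :: 'a projective. {rep_projective p, - rep_projective p})"
    by (rule finite_UN_I[OF fin]) simp
  ultimately have "finite (UNIV :: 'a usphere set)" by (rule finite_subset)
  then have "finite (range (Rep_usphere :: 'a usphere \<Rightarrow> 'a))" by simp
  then have finite_sphere: "finite (sphere (0::'a) 1)"
    by (simp add: type_definition.Rep_range[OF type_definition_usphere])
  have "connected (sphere (0::'a) 1)" using assms by (intro connected_sphere)
  with finite_sphere obtain a where a: "sphere (0::'a) 1 \<subseteq> {a}"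
    using connected_finite_iff_sing[of "sphere (0::'a) 1"] by auto
  obtain u :: 'a where u: "norm u = 1" using vector_choose_size[of 1] by auto
  moreover from u have "- u \<in> sphere 0 1" "u \<in> sphere 0 1" by simp_all
  ultimately have "u = a" "- u = a" using a by blast+
  then have "u \<bullet> u = - (u \<bullet> u)" by (metis inner_minus_right)
  with u show False by simp
qed

theorem theorem1:
  fixes d n :: nat
    and V :: "('a :: euclidean_space usphere \<Rightarrow> real) set"
  assumes "d \<ge> 1" and "n \<ge> 1"
    and "DIM('a) = d + 1"
    and "subspace V" and "dim V = n"
    and "\<And>f. f \<in> V \<Longrightarrow> continuous_on UNIV f"
    and "\<And>f. f \<in> V \<Longrightarrow> odd_map f"
  shows "\<exists>A :: 'a usphere set.
    diameter A \<le> pi - packing_distance (n + 1) (UNIV :: 'a projective set) \<and>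
    (\<forall>f\<in>V. \<not> (\<forall>x\<in>A. f x > 0))"
proof -
  let ?p = "packing_distance (n + 1) (UNIV :: 'a projective set)"
  have "infinite (UNIV :: 'a projective set)"
    using assms(1,3) by (intro infinite_UNIV_projective) simp
  then obtain q :: "nat \<Rightarrow> 'a projective"
    where q: "\<And>i j. i \<in> {1..n+1} \<Longrightarrow> j \<in> {1..n+1} \<Longrightarrow> i \<noteq> j \<Longrightarrow> ?p \<le> dist (q i) (q j)"
    using packing_distance_attained[OF compact_UNIV_projective, of "n + 1"] assms(2) by auto
  define y where "y = rep_projective \<circ> q"
  have y: "abs_projective (y i) = q i" for i
    by (simp add: y_def Quotient3_abs_rep[OF Quotient3_projective])
  obtain J z where J: "J \<subseteq> {1..n+1}" "J \<noteq> {}"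
    and z: "\<And>i. z i = y i \<or> z i = - y i"
    and nonpos: "\<And>f. f \<in> V \<Longrightarrow> \<not> (\<forall>i\<in>J. f (z i) > 0)"
    using odd_maps_not_positive_on_signed_points[of V "{1..n+1}" y] assms(2,5,7) by auto
  have zq: "abs_projective (z i) = q i" for i
    using z[of i] y[of i] by auto
  \<comment> \<open>The pairs of equal points need \<open>\<epsilon> \<le> \<pi>\<close>, which holds because all distances in \<open>\<real>P\<^sup>d\<close> are
    at most \<open>\<pi>/2\<close>.\<close>
  have "?p \<le> dist (q 1) (q 2)" using q assms(2) by simp
  also have "\<dots> \<le> pi / 2" by (rule dist_projective_le)
  finally have p_le: "?p \<le> pi" using pi_gt_zero by linarith
  have "dist (z i) (z j) \<le> pi - ?p" if "i \<in> J" "j \<in> J" for i j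
  proof (cases "i = j")
    case False
    then have "?p \<le> dist (q i) (q j)" using q J(1) that by blast
    then show ?thesis
      using dist_usphere_le_pi_minus_dist_projective[of "z i" "z j"] unfolding zq by linarith
  qed (use p_le in simp)
  then have "diameter (z ` J) \<le> pi - ?p"
    using J(2) by (auto simp: diameter_def intro!: cSUP_least)
  with nonpos show ?thesis by (intro exI[of _ "z ` J"]) auto
qed

end
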